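(* Let $(E,\pi,B)$ be a complex vector bundle with fibres of complex dimension $n$ and $L$ a ($\mathbb{C}$-)linear transport along paths in it, whose matrix in given bases along a path $\gamma:J\to B$ is $H(t,s;\gamma)=F^{-1}(t;\gamma)F(s;\gamma)$ for a nondegenerate complex matrix function $F$. Then any Hermitian bundle metric along $\gamma$ consistent with $L$ along $\gamma$ is given by $$G^{T}(\gamma(s);\gamma)=\bigl(F(s;\gamma)\bigr)^{*}C(\gamma)F(s;\gamma),\qquad s\in J,$$ where $C(\gamma)=C(\gamma)^{*}$ is a nondegenerate Hermitian matrix depending on $\gamma$ (but not on $s$).
   Context: A path in $B$ is a (continuous) map $\gamma:J\to B$ with $J$ an arbitrary real interval. A Hermitian bundle metric along $\gamma$ is a family, indexed by $s\in J$, of maps $g_{\gamma(s)}:\pi^{-1}(\gamma(s))\times\pi^{-1}(\gamma(s))\to\mathbb{C}$ that are sesquilinear (linear in the first and conjugate-linear in the second argument), nondegenerate, and Hermitian, $g_{\gamma(s)}(u,v)=\overline{g_{\gamma(s)}(v,u)}$. Positive definiteness is not assumed. A linear transport along paths $L$ assigns to each path $\gamma:J\to B$ and $s,t\in J$ a $\mathbb{C}$-linear map $L^\gamma_{s\to t}:\pi^{-1}(\gamma(s))\to\pi^{-1}(\gamma(t))$ with $L^\gamma_{t\to r}\circ L^\gamma_{s\to t}=L^\gamma_{s\to r}$ and $L^\gamma_{s\to s}=\mathrm{id}$ for all $r,s,t\in J$. The metric and $L$ are consistent along $\gamma$ if $g_{\gamma(s)}(u,v)=g_{\gamma(t)}(L^\gamma_{s\to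 t}u,L^\gamma_{s\to t}v)$ for all $s,t\in J$, $u,v\in\pi^{-1}(\gamma(s))$. In bases $\{e_i(s)\}$: $L^\gamma_{s\to t}e_j(s)=\sum_iH^{i}_{\;j}(t,s;\gamma)e_i(t)$, and $G(\gamma(s);\gamma)=[g_{\gamma(s)}(e_i(s),e_j(s))]_{ij}$. $T$ is transposition and $*$ is Hermitian conjugation (conjugate transpose) of matrices. *)

theory Defs
  imports
    "HOL-Analysis.Analysis"
    "Jordan_Normal_Form.VS_Connect"
    "Jordan_Normal_Form.Gauss_Jordan_Elimination"
    "Jordan_Normal_Form.Schur_Decomposition"
begin

text \<open>
  The fibre over \<open>x\<close> is a vector space \<open>fib x\<close> over \<^term>\<open>class_ring :: complex ring\<close>, carried by the
  preimage of \<open>x\<close> under the projection. The model fibre is the space of complex \<open>n\<close>-tuples, that is,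
  of functions extensional on \<open>{..<n}\<close>, with its product topology.
\<close>

definition local_trivialization ::
  "'e topology \<Rightarrow> 'b topology \<Rightarrow> ('e \<Rightarrow> 'b) \<Rightarrow> ('b \<Rightarrow> (complex, 'e) module) \<Rightarrow> nat
    \<Rightarrow> 'b set \<Rightarrow> ('e \<Rightarrow> 'b \<times> (nat \<Rightarrow> complex)) \<Rightarrow> bool"
where
  "local_trivialization E B \<pi> fib n U \<phi> \<longleftrightarrow>
     openin B U \<and>
     homeomorphic_map (subtopology E {u \<in> topspace E. \<pi> u \<in> U})
       (prod_topology (subtopology B U) (product_topology (\<lambda>_. euclidean) {..<n})) \<phi> \<and>
     (\<forall>u \<in> topspace E. \<pi> u \<in> U \<longrightarrow> fst (\<phi> u) = \<pi> u) \<and>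
     (\<forall>x \<in> U. \<forall>i < n.
        (\<forall>u \<in> carrier (fib x). \<forall>v \<in> carrier (fib x).
           snd (\<phi> (u \<oplus>\<^bsub>fib x\<^esub> v)) i = snd (\<phi> u) i + snd (\<phi> v) i) \<and>
        (\<forall>c. \<forall>u \<in> carrier (fib x). snd (\<phi> (c \<odot>\<^bsub>fib x\<^esub> u)) i = c * snd (\<phi> u) i))"

locale complex_vector_bundle =
  fixes E :: "'e topology" and \<pi> :: "'e \<Rightarrow> 'b" and B :: "'b topology"
    and fib :: "'b \<Rightarrow> (complex, 'e) module" and n :: nat
  assumes continuous_projection: "continuous_map E B \<pi>"
    and fibre_carrier: "\<And>x. x \<in> topspace B \<Longrightarrow> carrier (fib x) = {u \<in> topspace E. \<pi> u = x}"
    and fibre_vectorspace: "\<And>x. x \<in> topspace B \<Longrightarrow> vectorspace class_ring (fib x)"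
    and fibre_fin_dim: "\<And>x. x \<in> topspace B \<Longrightarrow> vectorspace.fin_dim class_ring (fib x)"
    and fibre_dim: "\<And>x. x \<in> topspace B \<Longrightarrow> vectorspace.dim class_ring (fib x) = n"
    and locally_trivial:
      "\<And>x. x \<in> topspace B \<Longrightarrow> \<exists>U \<phi>. x \<in> U \<and> local_trivialization E B \<pi> fib n U \<phi>"

text \<open>
  A path \<open>J \<rightarrow> B\<close> is given by its domain and a function made total by the value \<^term>\<open>undefined\<close>
  outside the domain, so that equal paths are represented by equal data.
\<close>

definition bundle_path :: "'b topology \<Rightarrow> real set \<Rightarrow> (real \<Rightarrow> 'b) \<Rightarrow> bool" where
  "bundle_path B J \<gamma> \<longleftrightarrow> is_interval J \<and> \<gamma> \<in> extensional J \<and> continuous_map (top_of_set J) B \<gamma>"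

definition linear_transport ::
  "'b topology \<Rightarrow> ('b \<Rightarrow> (complex, 'e) module)
    \<Rightarrow> (real set \<Rightarrow> (real \<Rightarrow> 'b) \<Rightarrow> real \<Rightarrow> real \<Rightarrow> 'e \<Rightarrow> 'e) \<Rightarrow> bool"
where
  "linear_transport B fib L \<longleftrightarrow>
     (\<forall>J \<gamma>. bundle_path B J \<gamma> \<longrightarrow>
        (\<forall>s \<in> J. \<forall>t \<in> J. linear_map class_ring (fib (\<gamma> s)) (fib (\<gamma> t)) (L J \<gamma> s t)) \<and>
        (\<forall>r \<in> J. \<forall>s \<in> J. \<forall>t \<in> J. \<forall>u \<in> carrier (fib (\<gamma> s)).
           L J \<gamma> t r (L J \<gamma> s t u) = L J \<gamma> s r u) \<and>
        (\<forall>s \<in> J. \<forall>u \<in> carrier (fib (\<gamma> s)). L J \<gamma> s s u = u))"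

text \<open>
  Bases are indexed by \<open>{..<n}\<close>. They and the metric below depend on the parameter \<open>s\<close>, not merely
  on the point \<open>\<gamma> s\<close>: a path may pass through a point more than once.
\<close>

definition bases_along ::
  "('b \<Rightarrow> (complex, 'e) module) \<Rightarrow> nat \<Rightarrow> real set \<Rightarrow> (real \<Rightarrow> 'b) \<Rightarrow> (real \<Rightarrow> nat \<Rightarrow> 'e) \<Rightarrow> bool"
where
  "bases_along fib n J \<gamma> e \<longleftrightarrow>
     (\<forall>s \<in> J. inj_on (e s) {..<n} \<and> vectorspace.basis class_ring (fib (\<gamma> s)) (e s ` {..<n}))"

definition is_transport_matrix ::
  "('b \<Rightarrow> (complex, 'e) module) \<Rightarrow> nat
    \<Rightarrow> (real set \<Rightarrow> (real \<Rightarrow> 'b) \<Rightarrow> real \<Rightarrow> real \<Rightarrow> 'e \<Rightarrow> 'e)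
    \<Rightarrow> real set \<Rightarrow> (real \<Rightarrow> 'b) \<Rightarrow> (real \<Rightarrow> nat \<Rightarrow> 'e) \<Rightarrow> (real \<Rightarrow> real \<Rightarrow> complex mat) \<Rightarrow> bool"
where
  "is_transport_matrix fib n L J \<gamma> e H \<longleftrightarrow>
     (\<forall>s \<in> J. \<forall>t \<in> J. H t s \<in> carrier_mat n n \<and>
        (\<forall>j < n. L J \<gamma> s t (e s j) =
           (\<Oplus>\<^bsub>fib (\<gamma> t)\<^esub> i \<in> {..<n}. (H t s $$ (i, j)) \<odot>\<^bsub>fib (\<gamma> t)\<^esub> e t i)))"

definition hermitian_form :: "(complex, 'e) module \<Rightarrow> ('e \<Rightarrow> 'e \<Rightarrow> complex) \<Rightarrow> bool" where
  "hermitian_form V h \<longleftrightarrow>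
     (\<forall>u \<in> carrier V. \<forall>v \<in> carrier V. \<forall>w \<in> carrier V.
        h (u \<oplus>\<^bsub>V\<^esub> v) w = h u w + h v w \<and> h w (u \<oplus>\<^bsub>V\<^esub> v) = h w u + h w v) \<and>
     (\<forall>c. \<forall>u \<in> carrier V. \<forall>v \<in> carrier V.
        h (c \<odot>\<^bsub>V\<^esub> u) v = c * h u v \<and> h u (c \<odot>\<^bsub>V\<^esub> v) = cnj c * h u v) \<and>
     (\<forall>u \<in> carrier V. \<forall>v \<in> carrier V. h u v = cnj (h v u))"

text \<open>Because of the Hermitian symmetry, nondegeneracy in one argument is nondegeneracy in both.\<close>

definition nondegenerate_form :: "(complex, 'e) module \<Rightarrow> ('e \<Rightarrow> 'e \<Rightarrow> complex) \<Rightarrow> bool" where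
  "nondegenerate_form V h \<longleftrightarrow>
     (\<forall>u \<in> carrier V. (\<forall>v \<in> carrier V. h u v = 0) \<longrightarrow> u = \<zero>\<^bsub>V\<^esub>)"

definition hermitian_metric_along ::
  "('b \<Rightarrow> (complex, 'e) module) \<Rightarrow> real set \<Rightarrow> (real \<Rightarrow> 'b) \<Rightarrow> (real \<Rightarrow> 'e \<Rightarrow> 'e \<Rightarrow> complex) \<Rightarrow> bool"
where
  "hermitian_metric_along fib J \<gamma> g \<longleftrightarrow>
     (\<forall>s \<in> J. hermitian_form (fib (\<gamma> s)) (g s) \<and> nondegenerate_form (fib (\<gamma> s)) (g s))"

definition consistent_along ::
  "('b \<Rightarrow> (complex, 'e) module) \<Rightarrow> (real set \<Rightarrow> (real \<Rightarrow> 'b) \<Rightarrow> real \<Rightarrow> real \<Rightarrow> 'e \<Rightarrow> 'e)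
    \<Rightarrow> real set \<Rightarrow> (real \<Rightarrow> 'b) \<Rightarrow> (real \<Rightarrow> 'e \<Rightarrow> 'e \<Rightarrow> complex) \<Rightarrow> bool"
where
  "consistent_along fib L J \<gamma> g \<longleftrightarrow>
     (\<forall>s \<in> J. \<forall>t \<in> J. \<forall>u \<in> carrier (fib (\<gamma> s)). \<forall>v \<in> carrier (fib (\<gamma> s)).
        g s u v = g t (L J \<gamma> s t u) (L J \<gamma> s t v))"

definition metric_matrix ::
  "nat \<Rightarrow> (real \<Rightarrow> nat \<Rightarrow> 'e) \<Rightarrow> (real \<Rightarrow> 'e \<Rightarrow> 'e \<Rightarrow> complex) \<Rightarrow> real \<Rightarrow> complex mat"
where
  "metric_matrix n e g s = mat n n (\<lambda>(i, j). g s (e s i) (e s j))"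

end

theory Submission
  imports Defs
begin

text \<open>
  Consistency of \<open>g\<close> with \<open>L\<close> reads \<open>G\<^sup>T(s) = H(t,s)\<^sup>* G\<^sup>T(t) H(t,s)\<close> in matrix form. Substituting
  \<open>H(t,s) = F(t)\<^sup>-\<^sup>1 F(s)\<close> for one fixed \<open>t\<close> gives the claim with \<open>C = (F(t)\<^sup>-\<^sup>1)\<^sup>* G\<^sup>T(t) F(t)\<^sup>-\<^sup>1\<close>, which is
  Hermitian and nondegenerate because \<open>G\<^sup>T(t)\<close> is.
\<close>

section \<open>Adjoints and inverses of complex matrices\<close>

lemma mat_adjoint_dim [simp]:
  "dim_row (mat_adjoint A) = dim_col A" "dim_col (mat_adjoint A) = dim_row A"
  by (simp_all add: mat_adjoint_def)

lemma mat_adjoint_carrier [simp]: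
  "A \<in> carrier_mat m n \<Longrightarrow> mat_adjoint A \<in> carrier_mat n m"
  by (metis carrier_matD carrier_matI mat_adjoint_dim)

lemma mat_adjoint_index [simp]:
  "i < dim_col A \<Longrightarrow> j < dim_row A \<Longrightarrow> mat_adjoint A $$ (i, j) = conjugate (A $$ (j, i))"
  by (simp add: mat_adjoint_def mat_of_rows_index)

lemma mat_adjoint_adjoint [simp]: "mat_adjoint (mat_adjoint A) = A"
  by (rule eq_matI) simp_all

lemma mat_adjoint_one [simp]: "mat_adjoint (1\<^sub>m n :: complex mat) = 1\<^sub>m n"
  by (rule eq_matI) auto

lemma mat_adjoint_mult:
  fixes A B :: "complex mat"
  assumes "A \<in> carrier_mat m k" "B \<in> carrier_mat k n"
  shows "mat_adjoint (A * B) = mat_adjoint B * mat_adjoint A"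
  using assms by (intro eq_matI) (auto simp: scalar_prod_def ac_simps)

text \<open>The definition of \<open>invertible_mat\<close> leaves the shape of the inverse open;
  comparing dimensions in the two products forces it to be square, so determinants multiply.
  Conversely, a nonzero determinant makes \<open>A\<close> a unit of the matrix ring.\<close>

lemma invertible_mat_iff_det_nonzero:
  fixes A :: "'a :: field mat"
  assumes "A \<in> carrier_mat n n"
  shows "invertible_mat A \<longleftrightarrow> det A \<noteq> 0"
proof
  assume "invertible_mat A"
  then obtain B where B: "A * B = 1\<^sub>m n" "B * A = 1\<^sub>m (dim_row B)"
    using assms by (auto simp: invertible_mat_def inverts_mat_def)
  have "dim_col B = n"
    using arg_cong[OF B(1), of dim_col] by simp
  moreover have "dim_row B = n"
    using arg_cong[OF B(2), of dim_col] assms by simp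
  ultimately have "B \<in> carrier_mat n n" by (intro carrier_matI)
  from det_mult[OF assms this] B(1) have "det A * det B = 1" by simp
  then show "det A \<noteq> 0" by auto
next
  assume "det A \<noteq> 0"
  from det_non_zero_imp_unit[OF assms this, of "()"]
  obtain B where "B \<in> carrier_mat n n" "B * A = 1\<^sub>m n" "A * B = 1\<^sub>m n"
    by (auto simp: Units_def ring_mat_simps)
  with assms show "invertible_mat A"
    unfolding invertible_mat_def inverts_mat_def square_mat.simps by (metis carrier_matD)
qed

text \<open>\<open>mat_inverse\<close> yields \<open>None\<close> only for non-units, which a
  nonzero determinant excludes, so \<open>the\<close> returns a genuine inverse.\<close>

lemma the_mat_inverse:
  fixes A :: "'a :: field mat"
  assumes A: "A \<in> carrier_mat n n" and "invertible_mat A"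
  shows "the (mat_inverse A) \<in> carrier_mat n n" "the (mat_inverse A) * A = 1\<^sub>m n"
proof -
  have "A \<in> Units (ring_mat TYPE('a) n ())"
    by (rule det_non_zero_imp_unit[OF A]) (use assms invertible_mat_iff_det_nonzero[OF A] in simp)
  then obtain B where "mat_inverse A = Some B"
    using mat_inverse(1)[OF A, where b = "()"] by auto
  with mat_inverse(2)[OF A this]
  show "the (mat_inverse A) \<in> carrier_mat n n" "the (mat_inverse A) * A = 1\<^sub>m n" by auto
qed

text \<open>Linear dependence is phrased with coefficients attached to vectors, while bases here are
  indexed families. Injectivity of \<open>b\<close> lets a coefficient move from an index to its
  vector.\<close>

lemma (in Module.module) lincomb_reindex:
  assumes "inj_on b I" and "b ` I \<subseteq> carrier M" and "x \<in> I \<rightarrow> carrier R"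
  shows "lincomb (x \<circ> the_inv_into I b) (b ` I) = (\<Oplus>\<^bsub>M\<^esub> i \<in> I. x i \<odot>\<^bsub>M\<^esub> b i)"
proof -
  have "lincomb (x \<circ> the_inv_into I b) (b ` I)
      = (\<Oplus>\<^bsub>M\<^esub> i \<in> I. (x \<circ> the_inv_into I b) (b i) \<odot>\<^bsub>M\<^esub> b i)"
    unfolding lincomb_def
    by (rule M.add.finprod_reindex) (use assms in \<open>auto simp: the_inv_into_f_f Pi_iff\<close>)
  also have "\<dots> = (\<Oplus>\<^bsub>M\<^esub> i \<in> I. x i \<odot>\<^bsub>M\<^esub> b i)"
    by (rule M.finsum_cong') (use assms in \<open>auto simp: the_inv_into_f_f Pi_iff\<close>)
  finally show ?thesis .
qed

section \<open>Hermitian forms on one complex vector space\<close>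

context
  fixes V :: "(complex, 'e) module" and h :: "'e \<Rightarrow> 'e \<Rightarrow> complex"
  assumes V: "vectorspace class_ring V" and h: "hermitian_form V h"
begin

interpretation vectorspace "class_ring :: complex ring" V
  by (rule V)

lemma hermitian_form_add:
  assumes "u \<in> carrier V" "v \<in> carrier V" "w \<in> carrier V"
  shows "h (u \<oplus>\<^bsub>V\<^esub> v) w = h u w + h v w" "h w (u \<oplus>\<^bsub>V\<^esub> v) = h w u + h w v"
  using h assms unfolding hermitian_form_def by blast+

lemma hermitian_form_smult:
  assumes "u \<in> carrier V" "v \<in> carrier V"
  shows "h (c \<odot>\<^bsub>V\<^esub> u) v = c * h u v" "h u (c \<odot>\<^bsub>V\<^esub> v) = cnj c * h u v"
  using h assms unfolding hermitian_form_def by blast+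

lemma hermitian_form_cnj:
  "u \<in> carrier V \<Longrightarrow> v \<in> carrier V \<Longrightarrow> cnj (h v u) = h u v"
  using h unfolding hermitian_form_def by metis

lemma hermitian_form_zero:
  assumes "w \<in> carrier V"
  shows "h \<zero>\<^bsub>V\<^esub> w = 0" "h w \<zero>\<^bsub>V\<^esub> = 0"
  using hermitian_form_add[of "\<zero>\<^bsub>V\<^esub>" "\<zero>\<^bsub>V\<^esub>" w] assms by auto

text \<open>Induction on \<open>I\<close>. The family \<open>b\<close> may be a basis indexed by
  numbers or the identity on a set of vectors; both cases occur below.\<close>

lemma hermitian_form_lincomb:
  assumes "finite I" "b \<in> I \<rightarrow> carrier V" "w \<in> carrier V"
  shows "h (\<Oplus>\<^bsub>V\<^esub> i \<in> I. x i \<odot>\<^bsub>V\<^esub> b i) w = (\<Sum>i \<in> I. x i * h (b i) w)"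
    and "h w (\<Oplus>\<^bsub>V\<^esub> i \<in> I. x i \<odot>\<^bsub>V\<^esub> b i) = (\<Sum>i \<in> I. cnj (x i) * h w (b i))"
  using assms
  by (induction I rule: finite_induct)
     (auto simp: hermitian_form_zero hermitian_form_add hermitian_form_smult M.finsum_insert
        smult_closed Pi_iff)

text \<open>A nonzero kernel vector of the matrix gives the coefficients of a vector
  \<open>u\<close> orthogonal to every basis vector, hence to the whole space. Nondegeneracy makes
  \<open>u\<close> zero, which contradicts linear independence.\<close>

lemma gram_matrix_det_nonzero:
  assumes nondeg: "nondegenerate_form V h"
    and inj: "inj_on b {..<n}" and basis: "basis (b ` {..<n})"
  shows "det (mat n n (\<lambda>(i, j). h (b j) (b i))) \<noteq> 0"
proof
  define A where "A = mat n n (\<lambda>(i, j). h (b j) (b i))"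
  have b: "b \<in> {..<n} \<rightarrow> carrier V"
    using basis by (auto simp: basis_def)
  assume "det (mat n n (\<lambda>(i, j). h (b j) (b i))) = 0"
  then obtain x where x: "x \<in> carrier_vec n" "x \<noteq> 0\<^sub>v n" "A *\<^sub>v x = 0\<^sub>v n"
    using det_0_iff_vec_prod_zero_field[of A n] by (auto simp: A_def)
  define u where "u = (\<Oplus>\<^bsub>V\<^esub> i \<in> {..<n}. (x $ i) \<odot>\<^bsub>V\<^esub> b i)"
  have u: "u \<in> carrier V"
    unfolding u_def using b by (auto intro!: M.finsum_closed smult_closed)
  \<comment> \<open>The transposed order of indices matters: the coefficients of \<open>u\<close>
    enter the first, linear slot unconjugated, so this value is exactly entry \<open>i\<close> of
    \<open>A *\<^sub>v x\<close>.\<close>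
  have ub: "h u (b i) = 0" if "i < n" for i
  proof -
    have "h u (b i) = (\<Sum>j<n. x $ j * h (b j) (b i))"
      unfolding u_def by (rule hermitian_form_lincomb) (use b that in auto)
    also have "\<dots> = (A *\<^sub>v x) $ i"
      using that x(1) by (simp add: A_def scalar_prod_def lessThan_atLeast0 mult.commute)
    finally show ?thesis using x(3) that by simp
  qed
  have "h u v = 0" if v: "v \<in> carrier V" for v
  proof -
    obtain a S where S: "finite S" "S \<subseteq> b ` {..<n}" "v = lincomb a S"
      using v basis unfolding basis_def span_def by blast
    have "h u v = (\<Sum>w \<in> S. cnj (a w) * h u w)"
      unfolding S(3) lincomb_def
      by (rule hermitian_form_lincomb) (use S u b in auto)
    also have "\<dots> = 0"
      by (rule sum.neutral) (use S ub in auto)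
    finally show ?thesis .
  qed
  with nondeg u have "u = \<zero>\<^bsub>V\<^esub>" by (auto simp: nondegenerate_form_def)
  \<comment> \<open>The vanishing \<open>u\<close> is rewritten as a combination over the set of
    basis vectors; its coefficient at \<open>b i\<close> is \<open>x $ i\<close>, nonzero for a
    suitable \<open>i\<close>.\<close>
  moreover have "lincomb (($) x \<circ> the_inv_into {..<n} b) (b ` {..<n}) = u"
    unfolding u_def by (rule lincomb_reindex) (use inj b in auto)
  moreover obtain i where i: "i < n" "x $ i \<noteq> 0"
    using x by (metis carrier_vecD eq_vecI index_zero_vec(1,2))
  ultimately have "lin_dep (b ` {..<n})"
    unfolding lin_dep_def
    by (intro exI[of _ "b ` {..<n}"] exI[of _ "($) x \<circ> the_inv_into {..<n} b"] exI[of _ "b i"])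
       (auto simp: the_inv_into_f_f[OF inj])
  with basis show False by (auto simp: basis_def)
qed

end

text \<open>The nesting of the sums is the one produced by expanding a sesquilinear form first in
  its linear slot and then in its conjugate-linear slot.\<close>

lemma mat_adjoint_mult_mult_index:
  fixes A M B :: "complex mat"
  assumes "A \<in> carrier_mat n n" "M \<in> carrier_mat n n" "i < n" "j < n"
  shows "(mat_adjoint A * M * A) $$ (i, j)
    = (\<Sum>k<n. A $$ (k, j) * (\<Sum>l<n. cnj (A $$ (l, i)) * M $$ (l, k)))"
  using assms by (auto simp: scalar_prod_def lessThan_atLeast0 mult.commute)

theorem proposition4p3:
  fixes E :: "'e topology" and \<pi> :: "'e \<Rightarrow> 'b" and B :: "'b topology"
    and fib :: "'b \<Rightarrow> (complex, 'e) module" and n :: nat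
    and L :: "real set \<Rightarrow> (real \<Rightarrow> 'b) \<Rightarrow> real \<Rightarrow> real \<Rightarrow> 'e \<Rightarrow> 'e"
    and J :: "real set" and \<gamma> :: "real \<Rightarrow> 'b"
    and e :: "real \<Rightarrow> nat \<Rightarrow> 'e"
    and H :: "real \<Rightarrow> real \<Rightarrow> complex mat" and F :: "real \<Rightarrow> complex mat"
    and g :: "real \<Rightarrow> 'e \<Rightarrow> 'e \<Rightarrow> complex"
  assumes "complex_vector_bundle E \<pi> B fib n"
    and "linear_transport B fib L"
    and "bundle_path B J \<gamma>"
    and "bases_along fib n J \<gamma> e"
    and "is_transport_matrix fib n L J \<gamma> e H"
    and "\<forall>s \<in> J. F s \<in> carrier_mat n n \<and> invertible_mat (F s)"
    and "\<forall>s \<in> J. \<forall>t \<in> J. H t s = the (mat_inverse (F t)) * F s"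
    and "hermitian_metric_along fib J \<gamma> g"
    and "consistent_along fib L J \<gamma> g"
  shows "\<exists>C \<in> carrier_mat n n. C = mat_adjoint C \<and> invertible_mat C \<and>
    (\<forall>s \<in> J. transpose_mat (metric_matrix n e g s) = mat_adjoint (F s) * C * F s)"
\<comment> \<open>Without a parameter there is no reference point \<open>t\<close>; the required
  identity is then vacuous and the identity matrix serves as \<open>C\<close>.\<close>
proof (cases "J = {}")
  case True
  then show ?thesis
    by (intro bexI[of _ "1\<^sub>m n"]) (auto simp: invertible_mat_iff_det_nonzero[of _ n])
next
  case False
  then obtain t where t: "t \<in> J" by blast
  have base: "\<gamma> s \<in> topspace B" if "s \<in> J" for s
    using assms(3) that by (auto simp: bundle_path_def continuous_map_def)
  have vs: "vectorspace class_ring (fib (\<gamma> s))" if "s \<in> J" for s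
    using complex_vector_bundle.fibre_vectorspace[OF assms(1) base[OF that]] .
  have basis: "inj_on (e s) {..<n}" "vectorspace.basis class_ring (fib (\<gamma> s)) (e s ` {..<n})"
    if "s \<in> J" for s
    using assms(4) that by (auto simp: bases_along_def)
  have e: "e s \<in> {..<n} \<rightarrow> carrier (fib (\<gamma> s))" if "s \<in> J" for s
    using basis(2)[OF that] by (auto simp: vectorspace.basis_def[OF vs[OF that]])
  have herm: "hermitian_form (fib (\<gamma> s)) (g s)" "nondegenerate_form (fib (\<gamma> s)) (g s)"
    if "s \<in> J" for s
    using assms(8) that by (auto simp: hermitian_metric_along_def)
  define M where "M s = transpose_mat (metric_matrix n e g s)" for s
  have M_eq: "M s = mat n n (\<lambda>(i, j). g s (e s j) (e s i))" for s
    by (auto simp: M_def metric_matrix_def)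
  have M [simp]: "M s \<in> carrier_mat n n" for s
    by (simp add: M_eq)
  \<comment> \<open>Hermitian symmetry of the metric, read entrywise.\<close>
  have M_adj: "mat_adjoint (M t) = M t"
    using e[OF t] by (intro eq_matI)
      (auto simp: M_eq hermitian_form_cnj[OF vs[OF t] herm(1)[OF t]] Pi_iff)
  have M_det: "det (M t) \<noteq> 0"
    unfolding M_eq
    by (rule gram_matrix_det_nonzero[OF vs[OF t] herm[OF t] basis[OF t]])
  \<comment> \<open>Both arguments of the transported metric are expanded in the basis at
    \<open>t\<close>. Since \<open>M\<close> is the transposed metric matrix, the column index
    \<open>j\<close> sits in the linear slot and the row index \<open>i\<close> in the
    conjugate-linear one, which puts the adjoint on the left factor.\<close>
  have M_transport: "M s = mat_adjoint (H t s) * M t * H t s" if s: "s \<in> J" for s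
  proof -
    have H: "H t s \<in> carrier_mat n n"
      and L: "\<And>j. j < n \<Longrightarrow> L J \<gamma> s t (e s j) =
           (\<Oplus>\<^bsub>fib (\<gamma> t)\<^esub> i \<in> {..<n}. (H t s $$ (i, j)) \<odot>\<^bsub>fib (\<gamma> t)\<^esub> e t i)"
      using assms(5) s t by (auto simp: is_transport_matrix_def)
    have "linear_map class_ring (fib (\<gamma> s)) (fib (\<gamma> t)) (L J \<gamma> s t)"
      using assms(2,3) s t by (auto simp: linear_transport_def)
    then interpret linear_map class_ring "fib (\<gamma> s)" "fib (\<gamma> t)" "L J \<gamma> s t" .
    note lincomb = hermitian_form_lincomb[OF vs[OF t] herm(1)[OF t] finite_lessThan e[OF t]]
    have "M s $$ (i, j) = (mat_adjoint (H t s) * M t * H t s) $$ (i, j)" if ij: "i < n" "j < n" for i j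
    proof -
      have es: "e s i \<in> carrier (fib (\<gamma> s))" "e s j \<in> carrier (fib (\<gamma> s))"
        using e[OF s] ij by auto
      then have Li: "L J \<gamma> s t (e s i) \<in> carrier (fib (\<gamma> t))"
        using f_hom by (auto simp: module_hom_def)
      have "M s $$ (i, j) = g s (e s j) (e s i)"
        using ij by (simp add: M_eq)
      also have "\<dots> = g t (L J \<gamma> s t (e s j)) (L J \<gamma> s t (e s i))"
        using assms(9) s t es unfolding consistent_along_def by blast
      also have "\<dots> = (\<Sum>k<n. H t s $$ (k, j) * g t (e t k) (L J \<gamma> s t (e s i)))"
        unfolding L[OF ij(2)] by (rule lincomb(1)[OF Li])
      also have "\<dots> = (\<Sum>k<n. H t s $$ (k, j) *
          (\<Sum>l<n. cnj (H t s $$ (l, i)) * M t $$ (l, k)))"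
      proof (rule sum.cong[OF refl])
        fix k assume k: "k \<in> {..<n}"
        have "g t (e t k) (L J \<gamma> s t (e s i))
            = (\<Sum>l<n. cnj (H t s $$ (l, i)) * g t (e t k) (e t l))"
          unfolding L[OF ij(1)] by (rule lincomb(2)) (use e[OF t] k in auto)
        also have "\<dots> = (\<Sum>l<n. cnj (H t s $$ (l, i)) * M t $$ (l, k))"
          using k by (intro sum.cong) (auto simp: M_eq)
        finally show "H t s $$ (k, j) * g t (e t k) (L J \<gamma> s t (e s i))
            = H t s $$ (k, j) * (\<Sum>l<n. cnj (H t s $$ (l, i)) * M t $$ (l, k))"
          by simp
      qed
      also have "\<dots> = (mat_adjoint (H t s) * M t * H t s) $$ (i, j)"
        by (rule mat_adjoint_mult_mult_index[OF H M ij, symmetric])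
      finally show ?thesis .
    qed
    then show ?thesis
      using H carrier_matD[OF M[of s]] by (intro eq_matI) simp_all
  qed
  define P where "P = the (mat_inverse (F t))"
  have F: "F s \<in> carrier_mat n n" if "s \<in> J" for s
    using assms(6) that by blast
  have P: "P \<in> carrier_mat n n" "P * F t = 1\<^sub>m n"
    unfolding P_def using the_mat_inverse assms(6) t by blast+
  define C where "C = mat_adjoint P * M t * P"
  have C: "C \<in> carrier_mat n n"
    using P by (auto simp: C_def)
  \<comment> \<open>Taking the adjoint reverses the product and exchanges the two outer factors,
    while \<open>M t\<close> is fixed by \<open>M_adj\<close>.\<close>
  have "C = mat_adjoint C"
    using P by (simp add: C_def mat_adjoint_mult[of _ n n _ n] mult_carrier_mat[of _ n n _ n]
        M_adj assoc_mult_mat[of _ n n _ n _ n])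
  moreover have "invertible_mat C"
  proof -
    have "det P * det (F t) = 1"
      using det_mult[OF P(1) F[OF t]] P(2) by simp
    then have "det P \<noteq> 0" by auto
    \<comment> \<open>The adjoint of \<open>P * F t = 1\<^sub>m n\<close> shows that
      \<open>mat_adjoint P\<close> is invertible too, so all three factors of \<open>C\<close> have
      nonzero determinant.\<close>
    have "mat_adjoint (F t) * mat_adjoint P = 1\<^sub>m n"
      using mat_adjoint_mult[OF P(1) F[OF t]] P(2) by simp
    then have "det (mat_adjoint (F t)) * det (mat_adjoint P) = 1"
      using det_mult[of "mat_adjoint (F t)" n "mat_adjoint P"] P(1) F[OF t] by simp
    then have "det (mat_adjoint P) \<noteq> 0" by auto
    with \<open>det P \<noteq> 0\<close> M_det P(1) have "det C \<noteq> 0"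
      by (simp add: C_def det_mult[of _ n] mult_carrier_mat[of _ n n _ n])
    then show ?thesis using invertible_mat_iff_det_nonzero[OF C] by simp
  qed
  moreover have "M s = mat_adjoint (F s) * C * F s" if s: "s \<in> J" for s
  proof -
    \<comment> \<open>Here \<open>H t s\<close> is replaced by \<open>P * F s\<close>. Regrouping
      moves the two factors depending on \<open>s\<close> outside and leaves \<open>C\<close>, built
      from the fixed \<open>t\<close> alone, in the middle.\<close>
    have "M s = mat_adjoint (P * F s) * M t * (P * F s)"
      using M_transport[OF s] assms(7) s t by (simp add: P_def)
    also have "\<dots> = mat_adjoint (F s) * C * F s"
      using P(1) F[OF s]
      by (simp add: C_def mat_adjoint_mult[of _ n n _ n] mult_carrier_mat[of _ n n _ n]
          assoc_mult_mat[of _ n n _ n _ n])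
    finally show ?thesis .
  qed
  ultimately show ?thesis using C by (auto simp: M_def)
qed

end
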